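(* Let $\mathbf{X} = \{X_t\}_{t\in[0,1]}$ be a Feller process with sample paths in $C[0,1]$, starting at $x_0 \in \mathbb{R}$ (i.e. $X_0 = x_0$ with probability one), which is symmetric about some $\mathbf{a} = \{a_t\}_{t\in[0,1]} \in C[0,1]$, i.e. the distribution of $\mathbf{X}-\mathbf{a}$ is the same as that of $\mathbf{a}-\mathbf{X}$. Assume that $X_t$ has a continuous distribution for every $t \in (0,1]$, and that for all $d \ge 1$ and $0 < t_1 < t_2 < \cdots < t_d \le 1$ the finite dimensional marginal $(X_{t_1},\ldots,X_{t_d})$ has a positive density in a neighbourhood of its center of symmetry $(a_{t_1},\ldots,a_{t_d})$. Let $J \ge 2$ be a fixed integer. Then the band depth with respect to the distribution of $\mathbf{X}$ vanishes identically on $C[0,1]$, i.e. $BD(\mathbf{x}) = 0$ for every $\mathbf{x} \in C[0,1]$. Moreover, the half-region depth of $\mathbf{a}$ is zero, i.e. $HRD(\mathbf{a}) = 0$.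
   Context: $C[0,1]$ is the space of real-valued continuous functions on $[0,1]$. Band depth: for a fixed integer $J\ge 2$, the band depth of $\mathbf{x} = \{x_t\}_{t\in[0,1]} \in C[0,1]$ relative to the distribution of a random element $\mathbf{X}=\{X_t\}_{t\in[0,1]} \in C[0,1]$ is $$BD(\mathbf{x}) = \sum_{j=2}^{J} P\left(\min_{1\le i\le j} X_{i,t} \le x_t \le \max_{1\le i\le j} X_{i,t}\ \ \forall\, t\in[0,1]\right),$$ where $\mathbf{X}_i = \{X_{i,t}\}_{t\in[0,1]}$, $1\le i\le J$, are independent copies of $\mathbf{X}$. Half-region depth: $$HRD(\mathbf{x}) = \min\left\{P\left(X_t \le x_t\ \forall\, t\in[0,1]\right),\ P\left(X_t \ge x_t\ \forall\, t\in[0,1]\right)\right\}.$$ Feller process (in the sense of Revuz and Yor, Continuous Martingales and Brownian Motion): a Markov process on $\mathbb{R}$ whose transition semigroup $(P_t)_{t\ge 0}$ is a Feller semigroup, i.e. a semigroup of positive linear contractions on the space $C_0(\mathbb{R})$ of continuous functions vanishing at infinity, with $P_0$ the identity and $\|P_t f - f\|_\infty \to 0$ as $t\downarrow 0$ for every $f\in C_0(\mathbb{R})$; here the process is considered on the time interval $[0,1]$ and has continuous sample paths. *)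

theory Defs
  imports "HOL-Probability.Probability"
begin

text \<open>
  \<open>C[0,1]\<close> with the uniform metric. Its elements are the continuous functions on \<open>{0..1}\<close>,
  represented as functions on \<^typ>\<open>real\<close> that are \<^const>\<open>undefined\<close> outside \<open>{0..1}\<close>.
\<close>

definition C01 :: "(real \<Rightarrow> real) metric" where
  "C01 = cfunspace (top_of_set {0..1}) euclidean_metric"

definition borel_C01 :: "(real \<Rightarrow> real) measure" where
  "borel_C01 = sigma (mspace C01) {U. openin (mtopology_of C01) U}"

lemma space_borel_C01:
  "space borel_C01 = {f \<in> extensional {0..1}. continuous_on {0..1} f}"
proof -
  have "Metric_space.mbounded UNIV dist (f ` {0..1})"
    if "continuous_on {0..1} f" for f :: "real \<Rightarrow> real"
  proof -
    have "bounded (f ` {0..1})"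
      using that by (intro compact_imp_bounded compact_continuous_image) auto
    then show ?thesis by simp
  qed
  then have "mspace C01 = {f \<in> extensional {0..1}. continuous_on {0..1} f}"
    by (auto simp: C01_def)
  moreover have "{U. openin (mtopology_of C01) U} \<subseteq> Pow (mspace C01)"
    using openin_subset by fastforce
  ultimately show ?thesis
    by (simp add: borel_C01_def space_measure_of)
qed

subsection \<open>Depths relative to a distribution on \<open>C[0,1]\<close>\<close>

text \<open>
  The coordinates \<open>X 1, \<dots>, X J\<close> of the product space are independent with common
  distribution \<open>\<mu>\<close>, i.e. they are the independent copies in the definition of the band depth.
\<close>

definition BD :: "(real \<Rightarrow> real) measure \<Rightarrow> nat \<Rightarrow> (real \<Rightarrow> real) \<Rightarrow> real" where
  "BD \<mu> J x = (\<Sum>j = 2..J.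
     measure (Pi\<^sub>M {1..J} (\<lambda>_. \<mu>))
       {X \<in> space (Pi\<^sub>M {1..J} (\<lambda>_. \<mu>)). \<forall>t\<in>{0..1}.
          Min ((\<lambda>i. X i t) ` {1..j}) \<le> x t \<and> x t \<le> Max ((\<lambda>i. X i t) ` {1..j})})"

definition HRD :: "(real \<Rightarrow> real) measure \<Rightarrow> (real \<Rightarrow> real) \<Rightarrow> real" where
  "HRD \<mu> x =
     min (measure \<mu> {y \<in> space \<mu>. \<forall>t\<in>{0..1}. y t \<le> x t})
         (measure \<mu> {y \<in> space \<mu>. \<forall>t\<in>{0..1}. y t \<ge> x t})"

subsection \<open>Feller processes on the real line\<close>

definition C0 :: "(real \<Rightarrow>\<^sub>C real) set" where
  "C0 = {f. (apply_bcontfun f \<longlongrightarrow> 0) at_infinity}"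

definition feller_semigroup ::
  "(real \<Rightarrow> (real \<Rightarrow>\<^sub>C real) \<Rightarrow> (real \<Rightarrow>\<^sub>C real)) \<Rightarrow> bool" where
  "feller_semigroup T \<longleftrightarrow>
     (\<forall>t\<ge>0. \<forall>f\<in>C0. T t f \<in> C0) \<and>
     (\<forall>t\<ge>0. \<forall>f\<in>C0. \<forall>g\<in>C0. T t (f + g) = T t f + T t g) \<and>
     (\<forall>t\<ge>0. \<forall>c. \<forall>f\<in>C0. T t (c *\<^sub>R f) = c *\<^sub>R T t f) \<and>
     (\<forall>t\<ge>0. \<forall>f\<in>C0. (\<forall>x. 0 \<le> apply_bcontfun f x) \<longrightarrow> (\<forall>x. 0 \<le> apply_bcontfun (T t f) x)) \<and>
     (\<forall>t\<ge>0. \<forall>f\<in>C0. norm (T t f) \<le> norm f) \<and>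
     (\<forall>f\<in>C0. T 0 f = f) \<and>
     (\<forall>s\<ge>0. \<forall>t\<ge>0. \<forall>f\<in>C0. T (s + t) f = T s (T t f)) \<and>
     (\<forall>f\<in>C0. ((\<lambda>t. norm (T t f - f)) \<longlongrightarrow> 0) (at_right 0))"

text \<open>
  Homogeneous transition functions; the second conjunct is the Chapman-Kolmogorov equation.
  As a Feller semigroup is only required to consist of contractions, the kernels may be
  sub-Markovian.
\<close>

definition transition_function :: "(real \<Rightarrow> real \<Rightarrow> real measure) \<Rightarrow> bool" where
  "transition_function P \<longleftrightarrow>
     (\<forall>t\<ge>0. P t \<in> borel \<rightarrow>\<^sub>M subprob_algebra borel) \<and>
     (\<forall>s\<ge>0. \<forall>t\<ge>0. \<forall>x. P (s + t) x = P s x \<bind> P t)"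

definition feller_transition_function :: "(real \<Rightarrow> real \<Rightarrow> real measure) \<Rightarrow> bool" where
  "feller_transition_function P \<longleftrightarrow>
     transition_function P \<and>
     (\<exists>T. feller_semigroup T \<and>
        (\<forall>t\<ge>0. \<forall>f\<in>C0. \<forall>x.
           apply_bcontfun (T t f) x = (\<integral>y. apply_bcontfun f y \<partial>P t x)))"

definition natural_filtration ::
  "'a measure \<Rightarrow> ('a \<Rightarrow> real \<Rightarrow> real) \<Rightarrow> real \<Rightarrow> 'a measure" where
  "natural_filtration M X s =
     sigma (space M) {(\<lambda>\<omega>. X \<omega> u) -` B \<inter> space M | u B. u \<in> {0..s} \<and> B \<in> sets borel}"

text \<open>The time parameter is restricted to \<open>{0..1}\<close>.\<close>

definition markov_process ::
  "'a measure \<Rightarrow> ('a \<Rightarrow> real \<Rightarrow> real) \<Rightarrow> (real \<Rightarrow> real \<Rightarrow> real measure) \<Rightarrow> bool" where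
  "markov_process M X P \<longleftrightarrow>
     (\<forall>t\<in>{0..1}. (\<lambda>\<omega>. X \<omega> t) \<in> borel_measurable M) \<and>
     (\<forall>s t. 0 \<le> s \<and> s < t \<and> t \<le> 1 \<longrightarrow>
        (\<forall>f :: real \<Rightarrow> ennreal. f \<in> borel_measurable borel \<longrightarrow>
           (AE \<omega> in M. nn_cond_exp M (natural_filtration M X s) (\<lambda>\<omega>. f (X \<omega> t)) \<omega> =
              (\<integral>\<^sup>+ y. f y \<partial>P (t - s) (X \<omega> s)))))"

definition feller_process :: "'a measure \<Rightarrow> ('a \<Rightarrow> real \<Rightarrow> real) \<Rightarrow> bool" where
  "feller_process M X \<longleftrightarrow> (\<exists>P. feller_transition_function P \<and> markov_process M X P)"

subsection \<open>Conditions on distributions\<close>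

definition symmetric_about ::
  "'a measure \<Rightarrow> ('a \<Rightarrow> real \<Rightarrow> real) \<Rightarrow> (real \<Rightarrow> real) \<Rightarrow> bool" where
  "symmetric_about M X a \<longleftrightarrow>
     distr M borel_C01 (\<lambda>\<omega>. \<lambda>t\<in>{0..1}. X \<omega> t - a t) =
     distr M borel_C01 (\<lambda>\<omega>. \<lambda>t\<in>{0..1}. a t - X \<omega> t)"

text \<open>
  \<open>\<real>\<^sup>d\<close> is the set of functions on \<open>{1..d}\<close> (\<^const>\<open>undefined\<close> elsewhere). The distribution
  \<open>\<nu>\<close> on \<open>\<real>\<^sup>d\<close> has a Lebesgue density on some open neighbourhood of \<open>c\<close> which is positive
  there; nothing is required of \<open>\<nu>\<close> away from that neighbourhood.
\<close>

definition positive_density_near ::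
  "nat \<Rightarrow> (nat \<Rightarrow> real) measure \<Rightarrow> (nat \<Rightarrow> real) \<Rightarrow> bool" where
  "positive_density_near d \<nu> c \<longleftrightarrow>
     (\<exists>U. \<exists>f :: (nat \<Rightarrow> real) \<Rightarrow> real.
        openin (product_topology (\<lambda>_. euclidean) {1..d}) U \<and> c \<in> U \<and>
        f \<in> borel_measurable (Pi\<^sub>M {1..d} (\<lambda>_. lborel)) \<and>
        (\<forall>y\<in>U. 0 < f y) \<and>
        (\<forall>B \<in> sets (Pi\<^sub>M {1..d} (\<lambda>_. lborel)). B \<subseteq> U \<longrightarrow>
           emeasure \<nu> B = (\<integral>\<^sup>+ y\<in>B. ennreal (f y) \<partial>Pi\<^sub>M {1..d} (\<lambda>_. lborel))))"

end

theory Submission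
  imports Defs
begin

text \<open>
  For every path \<open>x\<close> and \<open>t > 0\<close>, \<open>X\<^sub>t\<close> lies strictly above or strictly below \<open>x t\<close> with
  probability at least \<open>1/2\<close>, since its distribution has no atoms. Hence one of the two sides
  occurs for infinitely many \<open>t = 1/(n+1)\<close>. As in Blumenthal's zero-one law, the Feller property
  makes an event that depends only on the path near time \<open>0\<close> independent of each \<open>X\<^sub>t\<close>; therefore
  almost every path is strictly on that side at infinitely many times of any infinite subset of
  these times. By Fubini, finitely many independent copies are almost surely simultaneously on
  that side at some time, so \<open>x\<close> leaves their band.
\<close>

section \<open>Coordinate evaluations on C[0,1]\<close>

text \<open>Evaluation at a point is 1-Lipschitz for the uniform metric, so preimages of open sets
  are open and hence among the generators of \<open>borel_C01\<close>.\<close>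

lemma measurable_eval_borel_C01:
  assumes "t \<in> {0..1}"
  shows "(\<lambda>y. y t) \<in> borel_measurable borel_C01"
proof -
  have "Lipschitz_continuous_map C01 euclidean_metric (\<lambda>y. y t)"
    unfolding Lipschitz_continuous_map_def
  proof (intro conjI exI ballI)
    fix f g assume "f \<in> mspace C01" "g \<in> mspace C01"
    then show "mdist euclidean_metric (f t) (g t) \<le> 1 * mdist C01 f g"
      using assms mdist_cfunspace_imp_mdist_le[of f "top_of_set {0..1}" euclidean_metric g _ t]
      unfolding C01_def by simp
  qed simp
  then have "continuous_map (mtopology_of C01) euclidean (\<lambda>y. y t)"
    using Lipschitz_continuous_imp_continuous_map by fastforce
  then have "openin (mtopology_of C01) {y \<in> mspace C01. y t \<in> U}" if "open U" for U
    using that by (auto simp: continuous_map_def)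
  moreover have "{U. openin (mtopology_of C01) U} \<subseteq> Pow (mspace C01)"
    using openin_subset by fastforce
  ultimately show ?thesis
    by (intro borel_measurableI)
      (auto simp: borel_C01_def space_measure_of sets_measure_of vimage_def Int_def conj_commute
        intro!: sigma_sets.Basic)
qed

section \<open>Feller semigroups and left continuity in time\<close>

lemma C0_diff: "f \<in> C0 \<Longrightarrow> g \<in> C0 \<Longrightarrow> f - g \<in> C0"
  unfolding C0_def by (auto intro: tendsto_eq_intros)

lemma feller_semigroupD:
  assumes "feller_semigroup T" "0 \<le> t" "f \<in> C0"
  shows "T t f \<in> C0" "norm (T t f) \<le> norm f"
    and "g \<in> C0 \<Longrightarrow> T t (f + g) = T t f + T t g"
    and "0 \<le> s \<Longrightarrow> T (s + t) f = T s (T t f)"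
    and "((\<lambda>t. norm (T t f - f)) \<longlongrightarrow> 0) (at_right 0)"
  using assms unfolding feller_semigroup_def by simp_all

text \<open>By the semigroup law, \<open>T (t - h) f - T t f = T (t - h) (f - T h f)\<close>, and
  contractivity bounds this by \<open>norm (f - T h f)\<close>. Strong continuity at 0 therefore
  yields convergence at every later time. It is applied to the time that remains until
  \<open>t\<close> when the process is observed at a small time \<open>h\<close>.\<close>

lemma feller_semigroup_left_continuous:
  assumes T: "feller_semigroup T" and f: "f \<in> C0"
    and h: "h \<longlonglongrightarrow> 0" "\<And>n. 0 < h n" "\<And>n. h n \<le> t"
  shows "(\<lambda>n. T (t - h n) f) \<longlonglongrightarrow> T t f"
proof -
  note D = feller_semigroupD[OF T]
  have bound: "norm (T (t - h n) f - T t f) \<le> norm (T (h n) f - f)" for n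
  proof -
    have pos: "0 \<le> h n" "0 \<le> t - h n"
      using h(2)[of n] h(3)[of n] by auto
    have fh: "f - T (h n) f \<in> C0"
      using D(1)[OF pos(1) f] f C0_diff by blast
    have "T (t - h n) ((f - T (h n) f) + T (h n) f)
        = T (t - h n) (f - T (h n) f) + T (t - h n) (T (h n) f)"
      using D(3)[OF pos(2) fh D(1)[OF pos(1) f]] .
    moreover have "T ((t - h n) + h n) f = T (t - h n) (T (h n) f)"
      using D(4)[OF pos(1) f pos(2)] .
    ultimately have "T (t - h n) f - T t f = T (t - h n) (f - T (h n) f)"
      by simp
    moreover have "norm (T (t - h n) (f - T (h n) f)) \<le> norm (f - T (h n) f)"
      using D(2)[OF pos(2) fh] .
    ultimately show ?thesis
      by (simp add: norm_minus_commute)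
  qed
  have "((\<lambda>s. norm (T s f - f)) \<longlongrightarrow> 0) (at_right 0)"
    using D(5)[of 0, OF _ f] by simp
  moreover have "filterlim h (at_right 0) sequentially"
    using h(1,2) less_imp_neq[OF h(2)] by (auto simp: filterlim_at intro!: always_eventually)
  ultimately have "(\<lambda>n. norm (T (h n) f - f)) \<longlonglongrightarrow> 0"
    by (rule filterlim_compose)
  then have "(\<lambda>n. T (t - h n) f - T t f) \<longlonglongrightarrow> 0"
    by (rule Lim_null_comparison[rotated]) (use bound in auto)
  then show ?thesis
    by (simp add: LIM_zero_iff)
qed

section \<open>Natural filtration and the Markov property\<close>

lemma subalgebra_natural_filtration:
  assumes "markov_process M X P" "s \<le> 1"
  shows "subalgebra M (natural_filtration M X s)"
proof -
  have gen: "{(\<lambda>\<omega>. X \<omega> u) -` B \<inter> space M | u B. u \<in> {0..s} \<and> B \<in> sets borel} \<subseteq> sets M"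
    using assms unfolding markov_process_def by (auto intro: measurable_sets)
  have pow: "{(\<lambda>\<omega>. X \<omega> u) -` B \<inter> space M | u B. u \<in> {0..s} \<and> B \<in> sets borel} \<subseteq> Pow (space M)"
    by auto
  show ?thesis
    using sets.sigma_sets_subset[OF gen] pow
    unfolding subalgebra_def natural_filtration_def by (simp add: space_measure_of sets_measure_of)
qed

lemma measurable_natural_filtration:
  assumes "u \<in> {0..s}"
  shows "(\<lambda>\<omega>. X \<omega> u) \<in> borel_measurable (natural_filtration M X s)"
proof -
  have pow: "{(\<lambda>\<omega>. X \<omega> u) -` B \<inter> space M | u B. u \<in> {0..s} \<and> B \<in> sets borel} \<subseteq> Pow (space M)"
    by auto
  show ?thesis
    using assms unfolding natural_filtration_def
    by (intro measurableI) (unfold space_measure_of[OF pow] sets_measure_of[OF pow],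
      auto intro!: sigma_sets.Basic)
qed

text \<open>The definition of a Markov process speaks of conditional expectations in
  \<open>ennreal\<close> and of kernels. This form speaks of real integrals and the operators
  \<open>T\<close>, to which Feller continuity applies. Nonnegativity of \<open>f\<close> permits
  the passage between the two kinds of integral.\<close>

lemma markov_property_C0:
  assumes "prob_space M" and mk: "markov_process M X P" and tf: "transition_function P"
    and T: "\<And>t f x. 0 \<le> t \<Longrightarrow> f \<in> C0 \<Longrightarrow>
      apply_bcontfun (T t f) x = (\<integral>y. apply_bcontfun f y \<partial>P t x)"
    and st: "0 \<le> s" "s < t" "t \<le> 1"
    and A: "A \<in> sets (natural_filtration M X s)"
    and f: "f \<in> C0" "\<And>x. 0 \<le> apply_bcontfun f x"
  shows "(\<integral>\<omega>. indicator A \<omega> * apply_bcontfun f (X \<omega> t) \<partial>M)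
    = (\<integral>\<omega>. indicator A \<omega> * apply_bcontfun (T (t - s) f) (X \<omega> s) \<partial>M)"
proof -
  interpret prob_space M by fact
  have sub: "subalgebra M (natural_filtration M X s)"
    using subalgebra_natural_filtration[OF mk] st by simp
  interpret F: finite_measure_subalgebra M "natural_filtration M X s"
    by standard (rule sub)
  have [measurable]: "A \<in> sets M" "A \<in> sets (natural_filtration M X s)"
    using sub A unfolding subalgebra_def by auto
  have [measurable]: "(\<lambda>\<omega>. X \<omega> s) \<in> borel_measurable M" "(\<lambda>\<omega>. X \<omega> t) \<in> borel_measurable M"
    using mk st unfolding markov_process_def by auto
  have [measurable]: "apply_bcontfun g \<in> borel_measurable borel" for g :: "real \<Rightarrow>\<^sub>C real"
    by (intro borel_measurable_continuous_onI) simp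
  let ?f = "\<lambda>y. ennreal (apply_bcontfun f y)"
  \<comment> \<open>The kernel has mass at most 1, so the bounded function \<open>f\<close> is
    integrable and its \<open>ennreal\<close> integral is the real one that represents
    \<open>T\<close>.\<close>
  have kernel: "(\<integral>\<^sup>+ y. ?f y \<partial>P (t - s) x) = ennreal (apply_bcontfun (T (t - s) f) x)" for x
  proof -
    have "P (t - s) \<in> borel \<rightarrow>\<^sub>M subprob_algebra borel"
      using tf st unfolding transition_function_def by simp
    then have P: "P (t - s) x \<in> space (subprob_algebra borel)"
      by (rule measurable_space) simp
    then have sets: "sets (P (t - s) x) = sets borel" and "subprob_space (P (t - s) x)"
      by (auto simp: space_subprob_algebra)
    interpret P: subprob_space "P (t - s) x" by fact
    have "integrable (P (t - s) x) (apply_bcontfun f)"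
      using norm_bounded[of f]
      by (intro P.integrable_const_bound[where B = "norm f"])
        (auto simp: measurable_cong_sets[OF sets refl])
    then show ?thesis
      using T f st by (simp add: nn_integral_eq_integral)
  qed
  have pos: "0 \<le> apply_bcontfun (T (t - s) f) x" for x
    using T[of "t - s" f x] f st by simp
  have "(\<integral>\<^sup>+\<omega>. ennreal (indicator A \<omega> * apply_bcontfun f (X \<omega> t)) \<partial>M)
      = (\<integral>\<^sup>+\<omega>. indicator A \<omega> * ?f (X \<omega> t) \<partial>M)"
    by (intro nn_integral_cong) (auto split: split_indicator)
  also have "\<dots> = (\<integral>\<^sup>+\<omega>. indicator A \<omega> *
      nn_cond_exp M (natural_filtration M X s) (\<lambda>\<omega>. ?f (X \<omega> t)) \<omega> \<partial>M)"
    by (intro F.nn_cond_exp_intg[symmetric]) measurable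
  also have "\<dots> = (\<integral>\<^sup>+\<omega>. ennreal (indicator A \<omega> * apply_bcontfun (T (t - s) f) (X \<omega> s)) \<partial>M)"
  proof (rule nn_integral_cong_AE)
    have "?f \<in> borel_measurable borel" by measurable
    then have "AE \<omega> in M. nn_cond_exp M (natural_filtration M X s) (\<lambda>\<omega>. ?f (X \<omega> t)) \<omega>
        = (\<integral>\<^sup>+ y. ?f y \<partial>P (t - s) (X \<omega> s))"
      using mk st unfolding markov_process_def by blast
    then show "AE \<omega> in M. indicator A \<omega> *
        nn_cond_exp M (natural_filtration M X s) (\<lambda>\<omega>. ?f (X \<omega> t)) \<omega>
        = ennreal (indicator A \<omega> * apply_bcontfun (T (t - s) f) (X \<omega> s))"
      by eventually_elim (auto simp: kernel split: split_indicator)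
  qed
  finally show ?thesis
    using f pos by (subst (1 2) integral_eq_nn_integral) auto
qed

section \<open>Germ events at time 0\<close>

text \<open>The Markov property at a time decreasing to \<open>0\<close>, where the path converges to \<open>x0\<close>.\<close>

lemma germ_event_integral:
  assumes "prob_space M" and mk: "markov_process M X P" and tf: "transition_function P"
    and fs: "feller_semigroup T"
    and T: "\<And>t f x. 0 \<le> t \<Longrightarrow> f \<in> C0 \<Longrightarrow>
      apply_bcontfun (T t f) x = (\<integral>y. apply_bcontfun f y \<partial>P t x)"
    and cont: "\<And>\<omega>. \<omega> \<in> space M \<Longrightarrow> continuous_on {0..1} (X \<omega>)"
    and start: "AE \<omega> in M. X \<omega> 0 = x0"
    and t: "0 < t" "t \<le> 1"
    and A: "\<And>s. 0 < s \<Longrightarrow> s \<le> 1 \<Longrightarrow> A \<in> sets (natural_filtration M X s)"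
    and f: "f \<in> C0" "\<And>x. 0 \<le> apply_bcontfun f x"
  shows "(\<integral>\<omega>. indicator A \<omega> * apply_bcontfun f (X \<omega> t) \<partial>M)
    = measure M A * apply_bcontfun (T t f) x0"
proof -
  interpret prob_space M by fact
  have [measurable]: "A \<in> sets M"
    using A[of 1] subalgebra_natural_filtration[OF mk, of 1] unfolding subalgebra_def by auto
  have [measurable]: "apply_bcontfun g \<in> borel_measurable borel" for g :: "real \<Rightarrow>\<^sub>C real"
    by (intro borel_measurable_continuous_onI) simp
  \<comment> \<open>The shift by 2 keeps \<open>h n\<close> strictly below \<open>t\<close> already
    at \<open>n = 0\<close>, so the Markov property between \<open>h n\<close> and \<open>t\<close>
    applies to every \<open>n\<close>.\<close>
  define h where "h n = t / real (n + 2)" for n :: nat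
  have h: "0 < h n" "h n < t" "h n \<le> 1" for n
  proof -
    show "0 < h n" using t by (simp add: h_def)
    show "h n < t" using t by (simp add: h_def divide_less_eq)
    then show "h n \<le> 1" using t by simp
  qed
  have h0: "h \<longlonglongrightarrow> 0"
    unfolding h_def
    using LIMSEQ_ignore_initial_segment[OF lim_const_over_n[of t], of 2] by simp
  have [measurable]: "(\<lambda>\<omega>. X \<omega> (h n)) \<in> borel_measurable M" for n
    using mk h[of n] unfolding markov_process_def by auto
  have Tlim: "(\<lambda>n. T (t - h n) f) \<longlonglongrightarrow> T t f"
    by (rule feller_semigroup_left_continuous[OF fs f(1) h0]) (use h in \<open>auto intro: less_imp_le\<close>)
  \<comment> \<open>Function and argument vary together: the functions converge uniformly to
    \<open>T t f\<close>, and the arguments converge along the path to its starting point, where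
    \<open>T t f\<close> is continuous. Contractivity provides the dominating constant.\<close>
  have "(\<lambda>n. \<integral>\<omega>. indicator A \<omega> * apply_bcontfun (T (t - h n) f) (X \<omega> (h n)) \<partial>M)
    \<longlonglongrightarrow> (\<integral>\<omega>. indicator A \<omega> * apply_bcontfun (T t f) x0 \<partial>M)"
  proof (rule integral_dominated_convergence[where w = "\<lambda>_. norm f"])
    show "AE \<omega> in M. (\<lambda>n. indicator A \<omega> * apply_bcontfun (T (t - h n) f) (X \<omega> (h n)))
        \<longlonglongrightarrow> indicator A \<omega> * apply_bcontfun (T t f) x0"
      using start AE_space
    proof eventually_elim
      case (elim \<omega>)
      have "(\<lambda>n. X \<omega> (h n)) \<longlonglongrightarrow> X \<omega> 0"
        by (rule continuous_on_tendsto_compose[OF cont[OF elim(2)] h0])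
          (use h in \<open>auto intro: less_imp_le always_eventually\<close>)
      then have "(\<lambda>n. apply_bcontfun (T t f) (X \<omega> (h n))) \<longlonglongrightarrow> apply_bcontfun (T t f) x0"
        using elim(1)
        by (intro continuous_on_tendsto_compose[OF continuous_on_apply_bcontfun[of UNIV]]) auto
      moreover have "(\<lambda>n. apply_bcontfun (T (t - h n) f - T t f) (X \<omega> (h n))) \<longlonglongrightarrow> 0"
        by (rule Lim_null_comparison[where g = "\<lambda>n. norm (T (t - h n) f - T t f)"])
          (use Tlim in \<open>auto simp del: minus_bcontfun.rep_eq real_norm_def
            simp: LIM_zero_iff tendsto_norm_zero_iff intro!: always_eventually norm_bounded\<close>)
      ultimately have "(\<lambda>n. apply_bcontfun (T (t - h n) f) (X \<omega> (h n)))
          \<longlonglongrightarrow> apply_bcontfun (T t f) x0"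
        using tendsto_add by fastforce
      then show ?case
        by (rule tendsto_mult_left)
    qed
    show "AE \<omega> in M. norm (indicator A \<omega> * apply_bcontfun (T (t - h n) f) (X \<omega> (h n))) \<le> norm f" for n
    proof (rule AE_I2)
      fix \<omega>
      have "norm (apply_bcontfun (T (t - h n) f) (X \<omega> (h n))) \<le> norm (T (t - h n) f)"
        by (rule norm_bounded)
      also have "\<dots> \<le> norm f"
        using feller_semigroupD(2)[OF fs _ f(1)] h[of n] by simp
      finally show "norm (indicator A \<omega> * apply_bcontfun (T (t - h n) f) (X \<omega> (h n))) \<le> norm f"
        by (auto split: split_indicator)
    qed
  qed (auto intro!: borel_measurable_times borel_measurable_indicator measurable_compose[where g = "apply_bcontfun _"])
  \<comment> \<open>Since \<open>A\<close> lies in the sigma-algebra of every time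
    \<open>h n\<close>, the Markov property makes this sequence of integrals constant, so its value
    is the limit.\<close>
  moreover have "(\<integral>\<omega>. indicator A \<omega> * apply_bcontfun (T (t - h n) f) (X \<omega> (h n)) \<partial>M)
      = (\<integral>\<omega>. indicator A \<omega> * apply_bcontfun f (X \<omega> t) \<partial>M)" for n
    using markov_property_C0[OF assms(1) mk tf T, of "h n" t A f] h[of n] t A f by auto
  ultimately show ?thesis
    by (simp add: LIMSEQ_const_iff)
qed

text \<open>The integral formula for germ events, used for \<open>A\<close> and for the whole space,
  shows that the integral of f(X_t) over \<open>A\<close> is P(A) times its expectation for
  nonnegative f in \<open>C0\<close>. The set where \<open>g\<close> is positive is open, so its
  indicator is a pointwise limit of such functions with values in [0,1].\<close>

lemma germ_event_indep_coordinate: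
  assumes "prob_space M" and mk: "markov_process M X P"
    and ft: "feller_transition_function P"
    and cont: "\<And>\<omega>. \<omega> \<in> space M \<Longrightarrow> continuous_on {0..1} (X \<omega>)"
    and start: "AE \<omega> in M. X \<omega> 0 = x0"
    and t: "0 < t" "t \<le> 1"
    and A: "\<And>s. 0 < s \<Longrightarrow> s \<le> 1 \<Longrightarrow> A \<in> sets (natural_filtration M X s)"
    and g: "continuous_on UNIV (g :: real \<Rightarrow> real)"
  shows "measure M {\<omega> \<in> A. 0 < g (X \<omega> t)} = measure M A * measure M {\<omega> \<in> space M. 0 < g (X \<omega> t)}"
proof -
  interpret prob_space M by fact
  obtain T where tf: "transition_function P" and fs: "feller_semigroup T"
    and T: "\<And>t f x. 0 \<le> t \<Longrightarrow> f \<in> C0 \<Longrightarrow>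
      apply_bcontfun (T t f) x = (\<integral>y. apply_bcontfun f y \<partial>P t x)"
    using ft unfolding feller_transition_function_def by blast
  have AM[measurable]: "A \<in> sets M"
    using A[of 1] subalgebra_natural_filtration[OF mk, of 1] unfolding subalgebra_def by auto
  have [measurable]: "apply_bcontfun g \<in> borel_measurable borel" for g :: "real \<Rightarrow>\<^sub>C real"
    by (intro borel_measurable_continuous_onI) simp
  have [measurable]: "g \<in> borel_measurable borel"
    using g by (rule borel_measurable_continuous_onI)
  have [measurable]: "(\<lambda>\<omega>. X \<omega> t) \<in> borel_measurable M"
    using mk t unfolding markov_process_def by auto
  \<comment> \<open>The first factor tends to the indicator of \<open>0 < g y\<close>. The second is
    a continuous cutoff that vanishes for |y| \<ge> k, which places the product in
    \<open>C0\<close>.\<close>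
  define \<phi> where "\<phi> k y = min 1 (real k * max 0 (g y)) * max 0 (min 1 (real k - \<bar>y\<bar>))"
    for k :: nat and y :: real
  have \<phi>_bounds: "0 \<le> \<phi> k y" "\<phi> k y \<le> 1" for k y
    unfolding \<phi>_def by (auto intro!: mult_le_one mult_nonneg_nonneg)
  have \<phi>_cont: "continuous_on UNIV (\<phi> k)" for k
    unfolding \<phi>_def by (intro continuous_intros g)
  define f where "f k = Bcontfun (\<phi> k)" for k
  have f: "apply_bcontfun (f k) = \<phi> k" for k
    unfolding f_def using \<phi>_cont \<phi>_bounds
    by (intro Bcontfun_inverse bcontfun_normI[where b = 1]) auto
  have fC0: "f k \<in> C0" for k
  proof -
    have "eventually (\<lambda>y. 0 = \<phi> k y) at_infinity"
      unfolding eventually_at_infinity by (auto simp: \<phi>_def intro!: exI[of _ "real k"])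
    then have "(\<phi> k \<longlongrightarrow> 0) at_infinity"
      by (rule Lim_transform_eventually[OF tendsto_const])
    then show ?thesis
      by (simp add: C0_def f)
  qed
  have \<phi>_lim: "(\<lambda>k. \<phi> k y) \<longlonglongrightarrow> indicator {y. 0 < g y} y" for y
  proof (cases "0 < g y")
    case True
    \<comment> \<open>From \<open>K\<close> on, \<open>k * g y\<close> and
      \<open>k - \<bar>y\<bar>\<close> are both at least 1, so both factors equal 1.\<close>
    obtain K :: nat where K: "1 / g y + \<bar>y\<bar> + 1 \<le> real K"
      using real_arch_simple by blast
    have "\<phi> k y = 1" if "K \<le> k" for k
    proof -
      have k: "1 / g y + \<bar>y\<bar> + 1 \<le> real k" using K that by linarith
      have "0 < 1 / g y" using True by simp
      then have "1 / g y \<le> real k" "\<bar>y\<bar> + 1 \<le> real k" using k by linarith+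
      then show ?thesis using True by (simp add: \<phi>_def field_simps)
    qed
    then have "eventually (\<lambda>k. 1 = \<phi> k y) sequentially"
      by (auto simp: eventually_sequentially)
    then have "(\<lambda>k. \<phi> k y) \<longlonglongrightarrow> 1"
      by (rule Lim_transform_eventually[OF tendsto_const])
    then show ?thesis
      using True by simp
  next
    case False
    then show ?thesis by (simp add: \<phi>_def)
  qed
  have lim: "(\<lambda>k. \<integral>\<omega>. indicator B \<omega> * \<phi> k (X \<omega> t) \<partial>M)
      \<longlonglongrightarrow> measure M {\<omega> \<in> B. 0 < g (X \<omega> t)}" if B[measurable]: "B \<in> sets M" for B
  proof -
    have "(\<lambda>k. \<integral>\<omega>. indicator B \<omega> * \<phi> k (X \<omega> t) \<partial>M)
      \<longlonglongrightarrow> (\<integral>\<omega>. indicator B \<omega> * indicator {y. 0 < g y} (X \<omega> t) \<partial>M)"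
    proof (rule integral_dominated_convergence[where w = "\<lambda>_. 1"])
      show "AE \<omega> in M. (\<lambda>k. indicator B \<omega> * \<phi> k (X \<omega> t))
          \<longlonglongrightarrow> indicator B \<omega> * indicator {y. 0 < g y} (X \<omega> t)"
        by (intro AE_I2 tendsto_mult_left \<phi>_lim)
      show "AE \<omega> in M. norm (indicator B \<omega> * \<phi> k (X \<omega> t)) \<le> 1" for k
        using \<phi>_bounds by (intro AE_I2) (auto split: split_indicator)
    qed (unfold \<phi>_def, measurable)
    also have "(\<integral>\<omega>. indicator B \<omega> * indicator {y. 0 < g y} (X \<omega> t) \<partial>M)
        = (\<integral>\<omega>. indicat_real {\<omega> \<in> B. 0 < g (X \<omega> t)} \<omega> \<partial>M)"
      by (intro Bochner_Integration.integral_cong) (auto split: split_indicator)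
    also have "\<dots> = measure M {\<omega> \<in> B. 0 < g (X \<omega> t)}"
    proof -
      have "{\<omega> \<in> B. 0 < g (X \<omega> t)} = B \<inter> {\<omega> \<in> space M. 0 < g (X \<omega> t)}"
        using sets.sets_into_space[OF B] by auto
      also have "\<dots> \<in> sets M" by measurable
      finally show ?thesis by simp
    qed
    finally show ?thesis .
  qed
  have int: "(\<integral>\<omega>. indicator B \<omega> * \<phi> k (X \<omega> t) \<partial>M) = measure M B * apply_bcontfun (T t (f k)) x0"
    if "\<And>s. 0 < s \<Longrightarrow> s \<le> 1 \<Longrightarrow> B \<in> sets (natural_filtration M X s)" for B k
    using germ_event_integral[OF assms(1) mk tf fs T cont start t that fC0, of k] \<phi>_bounds
    by (simp add: f)
  \<comment> \<open>The whole space is a germ event of probability 1, so \<open>T t (f k) x0\<close>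
    can be replaced by the expectation of \<open>\<phi> k\<close> at the coordinate
    \<open>t\<close>.\<close>
  have "space M \<in> sets (natural_filtration M X s)" if "s \<le> 1" for s
    using subalgebra_natural_filtration[OF mk that] sets.top unfolding subalgebra_def by metis
  then have "(\<integral>\<omega>. indicator A \<omega> * \<phi> k (X \<omega> t) \<partial>M)
      = measure M A * (\<integral>\<omega>. indicator (space M) \<omega> * \<phi> k (X \<omega> t) \<partial>M)" for k
    using int[OF A, of k] int[of "space M" k] by (simp add: prob_space)
  then have "(\<lambda>k. \<integral>\<omega>. indicator A \<omega> * \<phi> k (X \<omega> t) \<partial>M)
      \<longlonglongrightarrow> measure M A * measure M {\<omega> \<in> space M. 0 < g (X \<omega> t)}"
    using tendsto_mult_left[OF lim[OF sets.top]] by presburger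
  then show ?thesis
    using LIMSEQ_unique lim[OF AM] by blast
qed


section \<open>Infinitely many one-sided times near 0\<close>

text \<open>
  The complement \<open>A\<close> of the event is a germ event, hence independent of each \<open>X (\<tau> n)\<close>; so
  infinitely many of the events, each of probability at least \<open>p\<close>, would meet \<open>A\<close> in a set of
  probability at least \<open>P(A) p\<close>.
\<close>

lemma infinitely_often_near_start:
  fixes g :: "nat \<Rightarrow> real \<Rightarrow> real" and \<tau> :: "nat \<Rightarrow> real"
  assumes "prob_space M" and mk: "markov_process M X P"
    and ft: "feller_transition_function P"
    and cont: "\<And>\<omega>. \<omega> \<in> space M \<Longrightarrow> continuous_on {0..1} (X \<omega>)"
    and start: "AE \<omega> in M. X \<omega> 0 = x0"
    and \<tau>: "\<tau> \<longlonglongrightarrow> 0" "\<And>n. 0 < \<tau> n" "\<And>n. \<tau> n \<le> 1"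
    and g: "\<And>n. continuous_on UNIV (g n)"
    and N: "infinite N"
    and p: "0 < p" "\<And>n. n \<in> N \<Longrightarrow> p \<le> measure M {\<omega> \<in> space M. 0 < g n (X \<omega> (\<tau> n))}"
  shows "AE \<omega> in M. infinite {n \<in> N. 0 < g n (X \<omega> (\<tau> n))}"
proof -
  interpret prob_space M by fact
  have [measurable]: "g n \<in> borel_measurable borel" for n
    using g by (rule borel_measurable_continuous_onI)
  have [measurable]: "(\<lambda>\<omega>. X \<omega> (\<tau> n)) \<in> borel_measurable M" for n
    using mk \<tau>(2)[of n] \<tau>(3)[of n] unfolding markov_process_def by auto
  define A where "A = {\<omega> \<in> space M. \<not> infinite {n \<in> N. 0 < g n (X \<omega> (\<tau> n))}}"
  define C where "C m = {\<omega> \<in> space M. \<exists>n\<ge>m. n \<in> N \<and> 0 < g n (X \<omega> (\<tau> n))}" for m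
  have A_germ: "A \<in> sets (natural_filtration M X s)" if s: "0 < s" "s \<le> 1" for s
  proof -
    obtain m0 where m0: "\<And>n. m0 \<le> n \<Longrightarrow> \<tau> n < s"
      using order_tendstoD(2)[OF \<tau>(1) s(1)] by (auto simp: eventually_sequentially)
    \<comment> \<open>Values at times after \<open>s\<close> are replaced by 0, so that every
      \<open>Y n\<close> is measurable at time \<open>s\<close>. From \<open>m0\<close> on nothing
      is replaced, and finiteness of the index set depends only on that tail.\<close>
    define Y where "Y n \<omega> = (if \<tau> n \<le> s then X \<omega> (\<tau> n) else 0)" for n \<omega>
    have [measurable]: "Y n \<in> borel_measurable (natural_filtration M X s)" for n
      unfolding Y_def using measurable_natural_filtration[of "\<tau> n" s X M] \<tau>(2)[of n]
      by (cases "\<tau> n \<le> s") auto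
    have "A = {\<omega> \<in> space M. \<exists>m. \<forall>n. max m m0 \<le> n \<longrightarrow> n \<in> N \<longrightarrow> \<not> 0 < g n (Y n \<omega>)}"
    proof -
      have "finite {n \<in> N. 0 < g n (X \<omega> (\<tau> n))} \<longleftrightarrow>
          (\<exists>m. \<forall>n. max m m0 \<le> n \<longrightarrow> n \<in> N \<longrightarrow> \<not> 0 < g n (Y n \<omega>))" for \<omega>
      proof -
        have "Y n \<omega> = X \<omega> (\<tau> n)" if "max m m0 \<le> n" for m n
          using m0[of n] that by (simp add: Y_def)
        then have "(\<exists>m. \<forall>n. max m m0 \<le> n \<longrightarrow> n \<in> N \<longrightarrow> \<not> 0 < g n (Y n \<omega>)) \<longleftrightarrow>
            (\<exists>m. \<forall>n. max m m0 \<le> n \<longrightarrow> n \<in> N \<longrightarrow> \<not> 0 < g n (X \<omega> (\<tau> n)))"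
          by metis
        also have "\<dots> \<longleftrightarrow> (\<exists>m. \<forall>n\<ge>m. \<not> (n \<in> N \<and> 0 < g n (X \<omega> (\<tau> n))))"
          by (metis max.bounded_iff max.cobounded2 max.orderE nle_le)
        also have "\<dots> \<longleftrightarrow> finite {n \<in> N. 0 < g n (X \<omega> (\<tau> n))}"
          using infinite_nat_iff_unbounded_le[of "{n \<in> N. 0 < g n (X \<omega> (\<tau> n))}"] by auto
        finally show ?thesis by simp
      qed
      then show ?thesis by (simp only: A_def not_not)
    qed
    also have "space M = space (natural_filtration M X s)"
      using subalgebra_natural_filtration[OF mk s(2)] unfolding subalgebra_def by simp
    also have "{\<omega> \<in> space (natural_filtration M X s).
        \<exists>m. \<forall>n. max m m0 \<le> n \<longrightarrow> n \<in> N \<longrightarrow> \<not> 0 < g n (Y n \<omega>)} \<in> sets (natural_filtration M X s)"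
      by measurable
    finally show ?thesis .
  qed
  have A_sets[measurable]: "A \<in> sets M"
    using A_germ[of 1] subalgebra_natural_filtration[OF mk, of 1] unfolding subalgebra_def by auto
  have C_sets[measurable]: "C m \<in> sets M" for m
    unfolding C_def by measurable
  have lower: "measure M A * p \<le> measure M (A \<inter> C m)" for m
  proof -
    obtain n where n: "m \<le> n" "n \<in> N"
      using N unfolding infinite_nat_iff_unbounded_le by blast
    have "measure M A * p \<le> measure M A * measure M {\<omega> \<in> space M. 0 < g n (X \<omega> (\<tau> n))}"
      by (intro mult_left_mono p n) simp
    also have "\<dots> = measure M {\<omega> \<in> A. 0 < g n (X \<omega> (\<tau> n))}"
      using germ_event_indep_coordinate[OF assms(1) mk ft cont start \<tau>(2,3) A_germ g] by simp
    also have "\<dots> \<le> measure M (A \<inter> C m)"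
      using n by (intro finite_measure_mono) (auto simp: C_def A_def)
    finally show ?thesis .
  qed
  \<comment> \<open>Continuity from above: the sets \<open>A \<inter> C m\<close> decrease to the
    empty set, because a point of \<open>A\<close> has only finitely many such indices. The uniform
    lower bound then forces \<open>A\<close> to be null.\<close>
  have "(\<lambda>m. measure M (A \<inter> C m)) \<longlonglongrightarrow> measure M (\<Inter>m. A \<inter> C m)"
    by (intro finite_Lim_measure_decseq) (auto simp: decseq_def C_def intro: order_trans)
  moreover have "(\<Inter>m. A \<inter> C m) = {}"
  proof -
    have "\<omega> \<notin> (\<Inter>m. A \<inter> C m)" for \<omega>
      using infinite_nat_iff_unbounded_le[of "{n \<in> N. 0 < g n (X \<omega> (\<tau> n))}"]
      by (auto simp: A_def C_def)
    then show ?thesis by blast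
  qed
  ultimately have "(\<lambda>m. measure M (A \<inter> C m)) \<longlonglongrightarrow> 0"
    by simp
  then have "measure M A * p \<le> 0"
    by (rule LIMSEQ_le_const) (use lower in auto)
  then have "measure M A = 0"
    using p(1) measure_nonneg[of M A] by (simp add: mult_le_0_iff)
  then have "AE \<omega> in M. \<omega> \<notin> A"
    using A_sets by (simp add: AE_iff_null_sets[symmetric] emeasure_eq_measure null_sets_def)
  then show ?thesis
    using AE_space by eventually_elim (auto simp: A_def)
qed

section \<open>Simultaneity for independent copies\<close>

text \<open>
  Given finitely many coordinates, the indices at which they all satisfy \<open>Q\<close> form an infinite set
  \<open>N\<close>, to which the hypothesis applies for the next coordinate.
\<close>

lemma AE_PiM_infinite_simultaneous:
  fixes Q :: "nat \<Rightarrow> 'b \<Rightarrow> bool"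
  assumes "prob_space \<mu>"
    and Q[measurable]: "\<And>n. Measurable.pred \<mu> (Q n)"
    and AE_Q: "\<And>N. infinite N \<Longrightarrow> N \<subseteq> N0 \<Longrightarrow> AE y in \<mu>. infinite {n \<in> N. Q n y}"
    and "infinite N0" "finite I"
  shows "AE Y in Pi\<^sub>M I (\<lambda>_. \<mu>). infinite {n \<in> N0. \<forall>i\<in>I. Q n (Y i)}"
  using \<open>finite I\<close>
proof (induction I rule: finite_induct)
  case empty
  then show ?case using \<open>infinite N0\<close> by simp
next
  case (insert i I)
  interpret prob_space \<mu> by fact
  interpret product_sigma_finite "\<lambda>_. \<mu>" by standard
  let ?M = "Pi\<^sub>M (insert i I) (\<lambda>_. \<mu>)"
  define B where "B = {Y \<in> space ?M. \<not> infinite {n \<in> N0. \<forall>j\<in>insert i I. Q n (Y j)}}"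
  have B[measurable]: "B \<in> sets ?M"
  proof -
    have [measurable]: "Measurable.pred ?M (\<lambda>Y. \<forall>j\<in>insert i I. Q n (Y j))" for n
      using insert.hyps(1)
      by (intro pred_intros_finite measurable_compose[where N = \<mu>, OF _ Q]
        measurable_component_singleton) auto
    show ?thesis
      \<comment> \<open>Infinitude becomes a countable combination: for every m some index n \<ge>
        m.\<close>
      unfolding B_def infinite_nat_iff_unbounded_le mem_Collect_eq by measurable
  qed
  have "emeasure ?M B = (\<integral>\<^sup>+ Y. indicator B Y \<partial>?M)"
    by simp
  also have "\<dots> = (\<integral>\<^sup>+ Y. (\<integral>\<^sup>+ y. indicator B (Y(i := y)) \<partial>\<mu>) \<partial>Pi\<^sub>M I (\<lambda>_. \<mu>))"
    by (rule product_nn_integral_insert[OF insert.hyps]) measurable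
  also have "\<dots> = (\<integral>\<^sup>+ Y. 0 \<partial>Pi\<^sub>M I (\<lambda>_. \<mu>))"
  proof (rule nn_integral_cong_AE)
    show "AE Y in Pi\<^sub>M I (\<lambda>_. \<mu>). (\<integral>\<^sup>+ y. indicator B (Y(i := y)) \<partial>\<mu>) = 0"
      using insert.IH
    proof eventually_elim
      case (elim Y)
      \<comment> \<open>The index set depends on the coordinates \<open>Y\<close> already fixed.
        This is why \<open>AE_Q\<close> is assumed for all infinite subsets of \<open>N0\<close> and
        not for \<open>N0\<close> alone.\<close>
      have "AE y in \<mu>. infinite {n \<in> {n \<in> N0. \<forall>j\<in>I. Q n (Y j)}. Q n y}"
        by (rule AE_Q[OF elim]) auto
      then have "AE y in \<mu>. indicator B (Y(i := y)) = (0 :: ennreal)"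
      proof eventually_elim
        case (elim y)
        have "{n \<in> N0. \<forall>j\<in>insert i I. Q n ((Y(i := y)) j)}
            = {n \<in> {n \<in> N0. \<forall>j\<in>I. Q n (Y j)}. Q n y}"
          using insert.hyps(2) by auto
        with elim show ?case by (simp add: B_def)
      qed
      then have "(\<integral>\<^sup>+ y. indicator B (Y(i := y)) \<partial>\<mu>) = (\<integral>\<^sup>+ y. 0 \<partial>\<mu>)"
        by (rule nn_integral_cong_AE)
      then show ?case by simp
    qed
  qed
  finally have "B \<in> null_sets ?M"
    using B by (simp add: null_sets_def)
  then show ?case
    by (rule AE_I') (auto simp: B_def)
qed

section \<open>The side on which paths leave a given function\<close>

text \<open>The sign \<open>\<sigma>\<close> encodes the side, 1 for above and -1 for below. It is
  fixed by \<open>x\<close> and the one-dimensional laws before \<open>I\<close> is chosen, so it is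
  the same for any number of copies. The single-path form serves the half-region depth, the product
  form the band depth.\<close>

lemma feller_paths_strictly_one_sided:
  assumes "prob_space M"
    and X: "X \<in> M \<rightarrow>\<^sub>M borel_C01"
    and fp: "feller_process M X"
    and start: "AE \<omega> in M. X \<omega> 0 = x0"
    and cdf: "\<And>t. t \<in> {0<..1} \<Longrightarrow> continuous_on UNIV (cdf (distr M borel (\<lambda>\<omega>. X \<omega> t)))"
  shows "\<exists>\<sigma>\<in>{1, - 1 :: real}.
    (AE y in distr M borel_C01 X. \<exists>t\<in>{0..1}. 0 < \<sigma> * (y t - x t)) \<and>
    (\<forall>I :: 'i set. finite I \<longrightarrow>
      (AE Y in Pi\<^sub>M I (\<lambda>_. distr M borel_C01 X). \<exists>t\<in>{0..1}. \<forall>i\<in>I. 0 < \<sigma> * (Y i t - x t)))"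
proof -
  interpret prob_space M by fact
  obtain P where ft: "feller_transition_function P" and mk: "markov_process M X P"
    using fp unfolding feller_process_def by blast
  have cont: "continuous_on {0..1} (X \<omega>)" if "\<omega> \<in> space M" for \<omega>
    using measurable_space[OF X that] by (simp add: space_borel_C01)
  define \<tau> where "\<tau> n = inverse (real (Suc n))" for n
  have \<tau>: "0 < \<tau> n" "\<tau> n \<le> 1" for n
    by (auto simp: \<tau>_def inverse_le_1_iff)
  have \<tau>0: "\<tau> \<longlonglongrightarrow> 0"
    unfolding \<tau>_def by (rule LIMSEQ_inverse_real_of_nat)
  have \<tau>_meas[measurable]: "(\<lambda>\<omega>. X \<omega> (\<tau> n)) \<in> borel_measurable M" for n
    using mk \<tau>[of n] unfolding markov_process_def by auto
  define p where "p \<sigma> n = measure M {\<omega> \<in> space M. 0 < \<sigma> * (X \<omega> (\<tau> n) - x (\<tau> n))}"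
    for \<sigma> :: real and n
  have p_sum: "p 1 n + p (- 1) n = 1" for n
  proof -
    interpret D: real_distribution "distr M borel (\<lambda>\<omega>. X \<omega> (\<tau> n))"
      by (intro real_distribution_distr) simp
    \<comment> \<open>Continuity of the distribution function at \<open>x (\<tau> n)\<close> says
      that this point is no atom, so the two strict sides share the full mass.\<close>
    have "isCont (cdf (distr M borel (\<lambda>\<omega>. X \<omega> (\<tau> n)))) (x (\<tau> n))"
      using cdf[of "\<tau> n"] \<tau>[of n] by (auto simp: continuous_on_eq_continuous_at)
    then have 0: "measure M {\<omega> \<in> space M. X \<omega> (\<tau> n) = x (\<tau> n)} = 0"
      by (simp add: D.isCont_cdf measure_distr vimage_def Int_def conj_commute)
    define E where "E \<sigma> = {\<omega> \<in> space M. 0 < \<sigma> * (X \<omega> (\<tau> n) - x (\<tau> n))}" for \<sigma> :: real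
    define Z where "Z = {\<omega> \<in> space M. X \<omega> (\<tau> n) = x (\<tau> n)}"
    have [measurable]: "E \<sigma> \<in> sets M" "Z \<in> sets M" for \<sigma>
      unfolding E_def Z_def by measurable
    have "space M = (E 1 \<union> E (- 1)) \<union> Z"
      by (auto simp: E_def Z_def)
    then have "1 = measure M ((E 1 \<union> E (- 1)) \<union> Z)"
      using prob_space by simp
    also have "\<dots> = measure M (E 1 \<union> E (- 1)) + measure M Z"
      by (intro finite_measure_Union) (auto simp: E_def Z_def)
    also have "measure M (E 1 \<union> E (- 1)) = measure M (E 1) + measure M (E (- 1))"
      by (intro finite_measure_Union) (auto simp: E_def)
    also have "\<dots> + measure M Z = p 1 n + p (- 1) n"
      using 0 by (simp add: p_def E_def Z_def)
    finally show ?thesis by simp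
  qed
  have "UNIV = {n. 1 / 2 \<le> p 1 n} \<union> {n. 1 / 2 \<le> p (- 1) n}"
  proof -
    have "1 / 2 \<le> p 1 n \<or> 1 / 2 \<le> p (- 1) n" for n
      using p_sum[of n] by linarith
    then show ?thesis by auto
  qed
  \<comment> \<open>Pigeonhole: at each index one side has probability at least 1/2, so one of the
    two sides does so at infinitely many indices.\<close>
  then have "infinite {n. 1 / 2 \<le> p 1 n} \<or> infinite {n. 1 / 2 \<le> p (- 1) n}"
    using infinite_UNIV_nat by (metis finite_Un)
  then obtain \<sigma> :: real where \<sigma>: "\<sigma> \<in> {1, - 1}" and N0: "infinite {n. 1 / 2 \<le> p \<sigma> n}"
    by auto
  let ?\<mu> = "distr M borel_C01 X"
  have \<mu>: "prob_space ?\<mu>"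
    by (rule prob_space_distr[OF X])
  have Q[measurable]: "Measurable.pred borel_C01 (\<lambda>y. 0 < \<sigma> * (y (\<tau> n) - x (\<tau> n)))" for n
  proof -
    have [measurable]: "(\<lambda>y. y (\<tau> n)) \<in> borel_measurable borel_C01"
      using \<tau>[of n] by (intro measurable_eval_borel_C01) auto
    show ?thesis by measurable
  qed
  have one: "AE y in ?\<mu>. infinite {n \<in> N. 0 < \<sigma> * (y (\<tau> n) - x (\<tau> n))}"
    if N: "infinite N" "N \<subseteq> {n. 1 / 2 \<le> p \<sigma> n}" for N
  proof -
    have "AE \<omega> in M. infinite {n \<in> N. 0 < (\<lambda>n y. \<sigma> * (y - x (\<tau> n))) n (X \<omega> (\<tau> n))}"
    proof (rule infinitely_often_near_start[OF assms(1) mk ft cont start \<tau>0 \<tau> _ N(1)])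
      show "1 / 2 \<le> measure M {\<omega> \<in> space M. 0 < \<sigma> * (X \<omega> (\<tau> n) - x (\<tau> n))}" if "n \<in> N" for n
        using that N(2) by (auto simp: p_def)
    qed (auto intro!: continuous_intros)
    moreover have "Measurable.pred borel_C01 (\<lambda>y. infinite {n \<in> N. 0 < \<sigma> * (y (\<tau> n) - x (\<tau> n))})"
      unfolding infinite_nat_iff_unbounded_le mem_Collect_eq by measurable
    ultimately show ?thesis
      by (subst AE_distr_iff[OF X]) (auto simp: pred_def)
  qed
  show ?thesis
  proof (intro bexI[OF _ \<sigma>] conjI allI impI)
    \<comment> \<open>\<open>R\<close> is instantiated with the condition on one path and with the
      joint condition on all paths in \<open>I\<close>; any index in the infinite set supplies the
      time.\<close>
    have witness: "\<exists>t\<in>{0..1}. R t" if "infinite {n \<in> {n. 1 / 2 \<le> p \<sigma> n}. R (\<tau> n)}" for R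
    proof -
      have "{n \<in> {n. 1 / 2 \<le> p \<sigma> n}. R (\<tau> n)} \<noteq> {}"
        using that by (rule infinite_imp_nonempty)
      then obtain n where "R (\<tau> n)"
        by blast
      then show ?thesis
        using \<tau>[of n] by (intro bexI[of _ "\<tau> n"]) auto
    qed
    show "AE y in ?\<mu>. \<exists>t\<in>{0..1}. 0 < \<sigma> * (y t - x t)"
      using one[OF N0 order_refl] by eventually_elim (rule witness)
    fix I :: "'i set" assume "finite I"
    have "AE Y in Pi\<^sub>M I (\<lambda>_. ?\<mu>).
        infinite {n \<in> {n. 1 / 2 \<le> p \<sigma> n}. \<forall>i\<in>I. 0 < \<sigma> * (Y i (\<tau> n) - x (\<tau> n))}"
      by (rule AE_PiM_infinite_simultaneous[OF \<mu> _ one N0 \<open>finite I\<close>]) auto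
    then show "AE Y in Pi\<^sub>M I (\<lambda>_. ?\<mu>). \<exists>t\<in>{0..1}. \<forall>i\<in>I. 0 < \<sigma> * (Y i t - x t)"
      by eventually_elim (rule witness)
  qed
qed

section \<open>Vanishing of the depths\<close>

text \<open>\<open>measure\<close> is 0 by convention on sets outside the sigma-algebra. Hence the
  depth events, which are conditions at uncountably many times, can be treated without a proof of
  their measurability.\<close>

lemma measure_eq_0_if_AE_notin:
  assumes "AE y in N. y \<notin> S"
  shows "measure N S = 0"
proof (cases "S \<in> sets N")
  case True
  then show ?thesis
    using assms by (simp add: AE_iff_null_sets[symmetric] null_sets_def measure_def)
qed (simp add: measure_notin_sets)

theorem theorem2p2:
  fixes M :: "'a measure"
    and X :: "'a \<Rightarrow> real \<Rightarrow> real"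
    and a :: "real \<Rightarrow> real"
    and x\<^sub>0 :: real
    and J :: nat
  assumes "prob_space M"
    and "X \<in> M \<rightarrow>\<^sub>M borel_C01"
    and "feller_process M X"
    and "AE \<omega> in M. X \<omega> 0 = x\<^sub>0"
    and "continuous_on {0..1} a"
    and "symmetric_about M X a"
    and "\<And>t. t \<in> {0<..1} \<Longrightarrow> continuous_on UNIV (cdf (distr M borel (\<lambda>\<omega>. X \<omega> t)))"
    and "\<And>(d::nat) (t :: nat \<Rightarrow> real). d \<ge> 1 \<Longrightarrow> strict_mono_on {1..d} t \<Longrightarrow> t ` {1..d} \<subseteq> {0<..1} \<Longrightarrow>
           positive_density_near d
             (distr M (Pi\<^sub>M {1..d} (\<lambda>_. borel)) (\<lambda>\<omega>. \<lambda>i\<in>{1..d}. X \<omega> (t i)))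
             (\<lambda>i\<in>{1..d}. a (t i))"
    and "J \<ge> 2"
  shows "(\<forall>x. continuous_on {0..1} x \<longrightarrow> BD (distr M borel_C01 X) J x = 0) \<and>
         HRD (distr M borel_C01 X) a = 0"
proof -
  let ?\<mu> = "distr M borel_C01 X"
  note one_sided = feller_paths_strictly_one_sided[OF assms(1-4,7)]
  have "BD ?\<mu> J x = 0" for x
  proof -
    obtain \<sigma> :: real where \<sigma>: "\<sigma> \<in> {1, - 1}"
      and AE: "AE Y in Pi\<^sub>M {1..J} (\<lambda>_. ?\<mu>). \<exists>t\<in>{0..1}. \<forall>i\<in>{1..J}. 0 < \<sigma> * (Y i t - x t)"
      using one_sided[where x = x] finite_atLeastAtMost by blast
    show ?thesis
      unfolding BD_def
    proof (intro sum.neutral ballI measure_eq_0_if_AE_notin)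
      fix j assume j: "j \<in> {2..J}"
      show "AE Y in Pi\<^sub>M {1..J} (\<lambda>_. ?\<mu>). Y \<notin> {X \<in> space (Pi\<^sub>M {1..J} (\<lambda>_. ?\<mu>)). \<forall>t\<in>{0..1}.
          Min ((\<lambda>i. X i t) ` {1..j}) \<le> x t \<and> x t \<le> Max ((\<lambda>i. X i t) ` {1..j})}"
        using AE
      proof eventually_elim
        case (elim Y)
        then obtain t where t: "t \<in> {0..1}" and side: "\<And>i. i \<in> {1..j} \<Longrightarrow> 0 < \<sigma> * (Y i t - x t)"
          using j by auto
        have ne: "finite ((\<lambda>i. Y i t) ` {1..j})" "(\<lambda>i. Y i t) ` {1..j} \<noteq> {}"
          using j by auto
        \<comment> \<open>Minimum and maximum are attained by members of the band. For
          \<open>\<sigma> = 1\<close> the minimum lies above \<open>x t\<close>, for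
          \<open>\<sigma> = - 1\<close> the maximum lies below it.\<close>
        have "\<not> (Min ((\<lambda>i. Y i t) ` {1..j}) \<le> x t \<and> x t \<le> Max ((\<lambda>i. Y i t) ` {1..j}))"
          using Min_in[OF ne] Max_in[OF ne] side \<sigma> by fastforce
        then show ?case using t by blast
      qed
    qed
  qed
  moreover have "HRD ?\<mu> a = 0"
  proof -
    obtain \<sigma> :: real where \<sigma>: "\<sigma> \<in> {1, - 1}"
      and AE: "AE y in ?\<mu>. \<exists>t\<in>{0..1}. 0 < \<sigma> * (y t - a t)"
      using one_sided[where x = a] by blast
    \<comment> \<open>A path that almost surely exceeds \<open>a\<close> somewhere gives probability
      0 to staying below \<open>a\<close>, and symmetrically for the other sign. One vanishing term
      makes the minimum in \<open>HRD\<close> vanish.\<close>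
    have "measure ?\<mu> {y \<in> space ?\<mu>. \<forall>t\<in>{0..1}. y t \<le> a t} = 0" if "\<sigma> = 1"
      using AE that by (intro measure_eq_0_if_AE_notin) (auto elim!: eventually_mono simp: not_le)
    moreover have "measure ?\<mu> {y \<in> space ?\<mu>. \<forall>t\<in>{0..1}. y t \<ge> a t} = 0" if "\<sigma> = - 1"
      using AE that by (intro measure_eq_0_if_AE_notin) (auto elim!: eventually_mono simp: not_le)
    ultimately show ?thesis
      using \<sigma> measure_nonneg[of ?\<mu>] unfolding HRD_def by (auto simp: min_def intro: antisym)
  qed
  ultimately show ?thesis by blast
qed

end
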